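(* Let $a>0$ and $\gamma\ge0$ be real. Then for every integer $n\ge0$, as polynomials in $x$, $$\mathscr{C}_n(x;a,\gamma)=\frac{(\gamma+1)_n}{n!}\sum_{k=0}^{n}(-a)^{-k}\frac{(-n)_k(\gamma-x)_k}{(\gamma+1)_k}\;{}_3F_2\left(\begin{array}{c}k-n,\ \gamma-x+k,\ \gamma\\ \gamma-x,\ \gamma+k+1\end{array}\Big|\,1\right).$$
   Context: The associated Charlier polynomials $\mathscr{C}_n(x;a,\gamma)$ are defined by $\mathscr{C}_{-1}=0$, $\mathscr{C}_0=1$ and, for $n\ge0$, $$a\,\mathscr{C}_{n+1}(x;a,\gamma)=(n+\gamma+a-x)\,\mathscr{C}_n(x;a,\gamma)-(n+\gamma)\,\mathscr{C}_{n-1}(x;a,\gamma).$$ Pochhammer symbol: $(b)_0=1$, $(b)_k=b(b+1)\cdots(b+k-1)$. The terminating series is ${}_3F_2\left(\begin{array}{c}k-n,a_2,a_3\\ b_1,b_2\end{array}\Big|1\right)=\sum_{j=0}^{n-k}\frac{(k-n)_j(a_2)_j(a_3)_j}{(b_1)_j(b_2)_j\,j!}$. Convention: the factor $(\gamma-x)_k(\gamma-x+k)_j/(\gamma-x)_j$ in each term is a polynomial in $x$ (equal to $(\gamma-x+j)_k$), so at the finitely many $x$ where $(\gamma-x)_j$ vanishes the right-hand side is understood by continuity in $x$. *)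

theory Defs
  imports "HOL-Analysis.Analysis" "HOL-Computational_Algebra.Polynomial"
begin

text \<open>
  Associated Charlier polynomials, as elements of \<^typ>\<open>real poly\<close>: the three-term recurrence solved
  for its leading term. The branch \<open>n = 0\<close> of the case expression is the initial value at index
  \<open>-1\<close>, which is \<open>0\<close>.
\<close>

fun assoc_charlier :: "real \<Rightarrow> real \<Rightarrow> nat \<Rightarrow> real poly" where
  "assoc_charlier a \<gamma> 0 = 1"
| "assoc_charlier a \<gamma> (Suc n) =
     smult (1 / a)
       ([:real n + \<gamma> + a, - 1:] * assoc_charlier a \<gamma> n
        - smult (real n + \<gamma>) (case n of 0 \<Rightarrow> 0 | Suc m \<Rightarrow> assoc_charlier a \<gamma> m))"

lemma assoc_charlier_1:
  assumes "a \<noteq> 0"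
  shows "smult a (assoc_charlier a \<gamma> 1) = [:\<gamma> + a, - 1:]"
  using assms by simp

lemma assoc_charlier_recurrence:
  assumes "a \<noteq> 0"
  shows "smult a (assoc_charlier a \<gamma> (Suc (Suc n))) =
           [:real (Suc n) + \<gamma> + a, - 1:] * assoc_charlier a \<gamma> (Suc n)
           - smult (real (Suc n) + \<gamma>) (assoc_charlier a \<gamma> n)"
  using assms by (subst assoc_charlier.simps(2)) (simp del: assoc_charlier.simps)

text \<open>
  The terminating series \<open>3F2(-m, a2, a3; b1, b2 | 1)\<close>. It has the intended value only if
  \<open>(b1)\<^sub>j\<close> and \<open>(b2)\<^sub>j\<close> are nonzero for all \<open>j \<le> m\<close>, since division by zero yields \<open>0\<close>.
\<close>

definition terminating_3F2 :: "nat \<Rightarrow> real \<Rightarrow> real \<Rightarrow> real \<Rightarrow> real \<Rightarrow> real" where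
  "terminating_3F2 m a2 a3 b1 b2 =
     (\<Sum>j=0..m. (pochhammer (- real m) j * pochhammer a2 j * pochhammer a3 j)
                / (pochhammer b1 j * pochhammer b2 j * fact j))"

text \<open>
  The explicit expression, as a function of the real variable \<open>x\<close>. Where \<open>(\<gamma> - x)\<^sub>j = 0\<close> for some
  \<open>j \<le> n\<close>, its literal value is an artefact of division by zero, and the meaningful value
  there is its limit.
\<close>

definition assoc_charlier_explicit :: "real \<Rightarrow> real \<Rightarrow> nat \<Rightarrow> real \<Rightarrow> real" where
  "assoc_charlier_explicit a \<gamma> n x =
     pochhammer (\<gamma> + 1) n / fact n *
       (\<Sum>k=0..n. (- a) powi (- int k)
          * (pochhammer (- real n) k * pochhammer (\<gamma> - x) k / pochhammer (\<gamma> + 1) k)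
          * terminating_3F2 (n - k) (\<gamma> - x + real k) \<gamma> (\<gamma> - x) (\<gamma> + real k + 1))"

end

theory Submission
  imports Defs
begin

text \<open>
  Collecting the terms with \<open>k + j = m\<close> turns the double sum into \<open>\<Sum>m\<le>n. C n m * S m\<close>, where only
  \<open>S m\<close> depends on \<open>x\<close>. It obeys the first-order recurrence
  \<open>S (m + 1) = - (\<gamma> - x + m) / a * S m + (\<gamma>)\<^sub>m\<^sub>+\<^sub>1 / (m + 1)!\<close>, while
  \<open>C (n + 1) (m + 1) = C n (m + 1) - C n m\<close> and \<open>(n - m) C n m = (n + \<gamma>) C (n - 1) m\<close>.
  Together these give the three-term recurrence; the inhomogeneous terms cancel because the
  alternating sum of a row of binomial coefficients vanishes.
\<close>

text \<open>For \<open>m \<le> n\<close> and \<open>\<gamma> \<ge> 0\<close> this is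
  \<open>(- 1) ^ m * ((n + \<gamma>) gchoose (n - m))\<close>. The value 0 for \<open>m > n\<close>
  has to be imposed, since truncated subtraction would give \<open>fact 0\<close> there; it lets
  sums run past \<open>n\<close>.\<close>

definition charlier_weight :: "real \<Rightarrow> nat \<Rightarrow> nat \<Rightarrow> real" where
  "charlier_weight \<gamma> n m =
     (if m \<le> n then (- 1) ^ m * pochhammer (\<gamma> + 1) n / (pochhammer (\<gamma> + 1) m * fact (n - m)) else 0)"

text \<open>The index \<open>j = m - k\<close> is that of the 3F2 series. The quotient of Pochhammer
  symbols in \<open>\<gamma> - x\<close> appears as the polynomial
  \<open>(\<gamma> - x + j)_k\<close>, so no denominator depends on \<open>x\<close>.\<close>

definition charlier_inner :: "real \<Rightarrow> real \<Rightarrow> real \<Rightarrow> nat \<Rightarrow> real" where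
  "charlier_inner a \<gamma> x m =
     (\<Sum>k\<le>m. (- 1 / a) ^ k * pochhammer (\<gamma> - x + real (m - k)) k
               * (pochhammer \<gamma> (m - k) / fact (m - k)))"

definition charlier_sum :: "real \<Rightarrow> real \<Rightarrow> real \<Rightarrow> nat \<Rightarrow> real" where
  "charlier_sum a \<gamma> x n = (\<Sum>m\<le>n. charlier_weight \<gamma> n m * charlier_inner a \<gamma> x m)"

section \<open>First-order identities for the inner sums and the weights\<close>

lemma pochhammer_Suc_pos:
  fixes \<gamma> :: real
  assumes "\<gamma> \<ge> 0"
  shows "pochhammer (\<gamma> + 1) m > 0"
  using assms by (intro pochhammer_pos) simp

lemma charlier_inner_0 [simp]: "charlier_inner a \<gamma> x 0 = 1"
  by (simp add: charlier_inner_def)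

text \<open>The term \<open>k = 0\<close> is the inhomogeneity. In every other term the last
  Pochhammer factor is \<open>\<gamma> - x + m\<close>, whatever \<open>k\<close> is, and comes out
  of the sum.\<close>

lemma charlier_inner_Suc:
  "charlier_inner a \<gamma> x (Suc m) =
     - (\<gamma> - x + real m) / a * charlier_inner a \<gamma> x m + pochhammer \<gamma> (Suc m) / fact (Suc m)"
proof -
  have step: "(- 1 / a) ^ Suc k * pochhammer (\<gamma> - x + real (m - k)) (Suc k) * c =
        - (\<gamma> - x + real m) / a * ((- 1 / a) ^ k * pochhammer (\<gamma> - x + real (m - k)) k * c)"
    if "k \<le> m" for k c
  proof -
    have "\<gamma> - x + real (m - k) + real k = \<gamma> - x + real m"
      using that by (simp add: of_nat_diff)
    then show ?thesis
      unfolding pochhammer_Suc by (simp only:) (simp add: divide_inverse algebra_simps)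
  qed
  have "charlier_inner a \<gamma> x (Suc m) = pochhammer \<gamma> (Suc m) / fact (Suc m) +
      (\<Sum>k\<le>m. (- 1 / a) ^ Suc k * pochhammer (\<gamma> - x + real (m - k)) (Suc k)
               * (pochhammer \<gamma> (m - k) / fact (m - k)))"
    unfolding charlier_inner_def sum.atMost_Suc_shift by simp
  also have "(\<Sum>k\<le>m. (- 1 / a) ^ Suc k * pochhammer (\<gamma> - x + real (m - k)) (Suc k)
               * (pochhammer \<gamma> (m - k) / fact (m - k))) =
      - (\<gamma> - x + real m) / a * charlier_inner a \<gamma> x m"
    unfolding charlier_inner_def sum_distrib_left by (intro sum.cong refl step) simp
  finally show ?thesis by simp
qed

text \<open>Pascal's rule for the generalized binomial coefficients behind the weights; the
  alternating sign turns its sum into a difference.\<close>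

lemma charlier_weight_Suc_Suc:
  assumes "\<gamma> \<ge> 0" "m \<le> n"
  shows "charlier_weight \<gamma> (Suc n) (Suc m) = charlier_weight \<gamma> n (Suc m) - charlier_weight \<gamma> n m"
proof (cases "m = n")
  \<comment> \<open>Here \<open>charlier_weight \<gamma> n (Suc m)\<close> is 0 by the default
    branch.\<close>
  case True
  have "pochhammer (\<gamma> + 1) n \<noteq> 0" "pochhammer (\<gamma> + 1) (Suc n) \<noteq> 0"
    using pochhammer_Suc_pos[OF assms(1)] less_irrefl by metis+
  then show ?thesis using True by (simp add: charlier_weight_def)
next
  case False
  then obtain d where d: "n = m + Suc d"
    using assms(2) by (metis add_Suc_right le_neq_implies_less less_imp_Suc_add)
  have "pochhammer (\<gamma> + 1) m \<noteq> 0" "\<gamma> + 1 + real m \<noteq> 0"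
    using pochhammer_Suc_pos[OF assms(1), of m] assms(1) by simp_all
  then show ?thesis unfolding d
    by (simp add: charlier_weight_def pochhammer_Suc divide_simps) (simp add: algebra_simps)
qed

text \<open>The surplus at the left edge equals the value found in
  \<open>charlier_weight_sum\<close>, against which it cancels later.\<close>

lemma charlier_weight_Suc_0:
  "charlier_weight \<gamma> (Suc n) 0 =
           charlier_weight \<gamma> n 0 + \<gamma> * pochhammer (\<gamma> + 1) n / fact (Suc n)"
  by (simp add: charlier_weight_def pochhammer_Suc divide_simps) (simp add: algebra_simps)

text \<open>Turns the remainder left by the one-step recurrence into a multiple of the preceding
  sum.\<close>

lemma charlier_weight_diff:
  assumes "m \<le> n"
  shows "real (Suc n - m) * charlier_weight \<gamma> (Suc n) m = (real (Suc n) + \<gamma>) * charlier_weight \<gamma> n m"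
  using assms by (simp add: charlier_weight_def pochhammer_Suc Suc_diff_le divide_simps del: of_nat_Suc)

text \<open>Multiplied by \<open>fact (Suc n)\<close>, the left side is row \<open>Suc n\<close> of
  the alternating binomial sum without its first entry 1 and with the sign reversed; the full row
  sums to 0.\<close>

lemma alternating_sum_inverse_fact:
  "(\<Sum>m\<le>n. (- 1) ^ m / (fact (n - m) * fact (Suc m)) :: real) = 1 / fact (Suc n)"
proof -
  have "(\<Sum>k\<le>Suc n. (- 1) ^ k * of_nat (Suc n choose k) :: real) = 0"
    by (rule choose_alternating_sum) simp
  then have "(\<Sum>m\<le>n. (- 1) ^ m * real (Suc n choose Suc m)) = 1"
    by (simp add: sum.atMost_Suc_shift sum_negf del: sum.atMost_Suc binomial_Suc_Suc)
  moreover have "(\<Sum>m\<le>n. (- 1) ^ m * real (Suc n choose Suc m)) =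
      fact (Suc n) * (\<Sum>m\<le>n. (- 1) ^ m / (fact (n - m) * fact (Suc m)))"
    unfolding sum_distrib_left
  proof (intro sum.cong refl)
    fix m assume "m \<in> {..n}"
    then show "(- 1) ^ m * real (Suc n choose Suc m) =
      fact (Suc n) * ((- 1) ^ m / (fact (n - m) * fact (Suc m)))"
      by (simp add: binomial_fact mult.commute del: fact_Suc binomial_Suc_Suc)
  qed
  ultimately have "fact (Suc n) * (\<Sum>m\<le>n. (- 1) ^ m / (fact (n - m) * fact (Suc m)) :: real) = 1"
    by simp
  then show ?thesis
    by (metis fact_nonzero nonzero_mult_div_cancel_left)
qed

text \<open>Since \<open>pochhammer \<gamma> (Suc m) = \<gamma> * pochhammer (\<gamma> + 1)
  m\<close>, the Pochhammer denominator of the weight cancels and an alternating sum free of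
  \<open>\<gamma>\<close> remains.\<close>

lemma charlier_weight_sum:
  assumes "\<gamma> \<ge> 0"
  shows "(\<Sum>m\<le>n. charlier_weight \<gamma> n m * (pochhammer \<gamma> (Suc m) / fact (Suc m))) =
           \<gamma> * pochhammer (\<gamma> + 1) n / fact (Suc n)"
proof -
  have "charlier_weight \<gamma> n m * (pochhammer \<gamma> (Suc m) / fact (Suc m)) =
        \<gamma> * pochhammer (\<gamma> + 1) n * ((- 1) ^ m / (fact (n - m) * fact (Suc m)))" if "m \<le> n" for m
    using that pochhammer_Suc_pos[OF assms, of m]
    by (simp add: charlier_weight_def pochhammer_rec del: fact_Suc)
  then have "(\<Sum>m\<le>n. charlier_weight \<gamma> n m * (pochhammer \<gamma> (Suc m) / fact (Suc m))) =
        \<gamma> * pochhammer (\<gamma> + 1) n * (\<Sum>m\<le>n. (- 1) ^ m / (fact (n - m) * fact (Suc m)))"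
    unfolding sum_distrib_left by (intro sum.cong refl) simp
  then show ?thesis
    by (simp only: alternating_sum_inverse_fact) simp
qed

section \<open>The three-term recurrence for the sums\<close>

lemma charlier_sum_Suc:
  assumes "a \<noteq> 0" "\<gamma> \<ge> 0"
  shows "a * charlier_sum a \<gamma> x (Suc n) =
           (real n + \<gamma> + a - x) * charlier_sum a \<gamma> x n
           - (\<Sum>m\<le>n. real (n - m) * charlier_weight \<gamma> n m * charlier_inner a \<gamma> x m)"
proof -
  let ?C = "charlier_weight \<gamma>" and ?S = "charlier_inner a \<gamma> x"
  let ?r = "\<gamma> * pochhammer (\<gamma> + 1) n / fact (Suc n)"
  \<comment> \<open>The added term \<open>m = Suc n\<close> has weight 0; after the index shift the
    range is again \<open>m \<le> n\<close>.\<close>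
  have R: "charlier_sum a \<gamma> x n = ?C n 0 + (\<Sum>m\<le>n. ?C n (Suc m) * ?S (Suc m))"
  proof -
    have "charlier_sum a \<gamma> x n = (\<Sum>m\<le>Suc n. ?C n m * ?S m)"
      by (simp add: charlier_sum_def charlier_weight_def)
    then show ?thesis
      by (simp add: sum.atMost_Suc_shift del: sum.atMost_Suc)
  qed
  \<comment> \<open>Writing \<open>\<gamma> - x + m\<close> as
    \<open>(\<gamma> - x + n) - (n - m)\<close> makes the first part independent of
    \<open>m\<close>.\<close>
  have "(\<Sum>m\<le>n. ?C n m * ?S (Suc m)) =
      (\<Sum>m\<le>n. - (1 / a) * ((\<gamma> - x + real n) * (?C n m * ?S m) - real (n - m) * ?C n m * ?S m)
              + ?C n m * (pochhammer \<gamma> (Suc m) / fact (Suc m)))"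
    by (intro sum.cong refl) (simp add: charlier_inner_Suc of_nat_diff divide_inverse algebra_simps)
  also have "\<dots> = - (1 / a) * ((\<gamma> - x + real n) * charlier_sum a \<gamma> x n
        - (\<Sum>m\<le>n. real (n - m) * ?C n m * ?S m)) + ?r"
    by (simp only: sum.distrib charlier_weight_sum[OF assms(2)] sum_subtractf
        sum_distrib_left[symmetric] charlier_sum_def)
  finally have shifted: "(\<Sum>m\<le>n. ?C n m * ?S (Suc m)) = \<dots>" .
  have "charlier_sum a \<gamma> x (Suc n) =
      ?C (Suc n) 0 + (\<Sum>m\<le>n. ?C (Suc n) (Suc m) * ?S (Suc m))"
    by (simp add: charlier_sum_def sum.atMost_Suc_shift del: sum.atMost_Suc)
  also have "\<dots> = ?C n 0 + ?r + (\<Sum>m\<le>n. ?C n (Suc m) * ?S (Suc m) - ?C n m * ?S (Suc m))"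
    unfolding charlier_weight_Suc_0
    by (intro arg_cong2[where f = "(+)"] sum.cong refl)
       (simp add: charlier_weight_Suc_Suc[OF assms(2)] left_diff_distrib)
  also have "\<dots> = charlier_sum a \<gamma> x n + ?r - (\<Sum>m\<le>n. ?C n m * ?S (Suc m))"
    by (simp add: R sum_subtractf del: fact_Suc)
  \<comment> \<open>The surplus \<open>?r\<close> from the weight at 0 cancels the one from the
    inhomogeneous terms.\<close>
  also have "\<dots> = charlier_sum a \<gamma> x n + (1 / a) * ((\<gamma> - x + real n) * charlier_sum a \<gamma> x n
        - (\<Sum>m\<le>n. real (n - m) * ?C n m * ?S m))"
    unfolding shifted by simp
  finally show ?thesis
    using assms(1) by (simp add: field_simps)
qed

lemma charlier_sum_0 [simp]: "charlier_sum a \<gamma> x 0 = 1"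
  by (simp add: charlier_sum_def charlier_weight_def)

lemma charlier_sum_1:
  assumes "a \<noteq> 0" "\<gamma> \<ge> 0"
  shows "a * charlier_sum a \<gamma> x (Suc 0) = \<gamma> + a - x"
  using charlier_sum_Suc[OF assms, of x 0] by simp

lemma charlier_sum_recurrence:
  assumes "a \<noteq> 0" "\<gamma> \<ge> 0"
  shows "a * charlier_sum a \<gamma> x (Suc (Suc n)) =
           (real (Suc n) + \<gamma> + a - x) * charlier_sum a \<gamma> x (Suc n)
           - (real (Suc n) + \<gamma>) * charlier_sum a \<gamma> x n"
proof -
  \<comment> \<open>The top term drops out because its factor \<open>Suc n - m\<close> is 0.\<close>
  have "(\<Sum>m\<le>Suc n. real (Suc n - m) * charlier_weight \<gamma> (Suc n) m * charlier_inner a \<gamma> x m) =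
        (\<Sum>m\<le>n. real (Suc n - m) * charlier_weight \<gamma> (Suc n) m * charlier_inner a \<gamma> x m)"
    by simp
  also have "\<dots> =
        (\<Sum>m\<le>n. (real (Suc n) + \<gamma>) * (charlier_weight \<gamma> n m * charlier_inner a \<gamma> x m))"
    by (intro sum.cong refl) (simp only: charlier_weight_diff atMost_iff mult.assoc[symmetric])
  finally have "(\<Sum>m\<le>Suc n. real (Suc n - m) * charlier_weight \<gamma> (Suc n) m
      * charlier_inner a \<gamma> x m) = \<dots>" .
  then show ?thesis
    by (simp only: charlier_sum_Suc[OF assms, of x "Suc n"] sum_distrib_left[symmetric]
        charlier_sum_def[of a \<gamma> x n])
qed

text \<open>Both families have the same two initial values and the same three-term recurrence, whose
  factor \<open>a\<close> cancels.\<close>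

lemma poly_assoc_charlier:
  assumes "a \<noteq> 0" "\<gamma> \<ge> 0"
  shows "poly (assoc_charlier a \<gamma> n) x = charlier_sum a \<gamma> x n"
proof (induction n rule: induct_nat_012)
  case 0
  show ?case by simp
next
  case 1
  have "a * poly (assoc_charlier a \<gamma> 1) x = \<gamma> + a - x"
    using arg_cong[OF assoc_charlier_1[OF assms(1), of \<gamma>], of "\<lambda>p. poly p x"]
    by (simp del: assoc_charlier.simps)
  then show ?case
    using charlier_sum_1[OF assms, of x] assms(1)
    by (metis One_nat_def mult_left_cancel)
next
  case (ge2 n)
  have "a * poly (assoc_charlier a \<gamma> (Suc (Suc n))) x =
      (real (Suc n) + \<gamma> + a - x) * poly (assoc_charlier a \<gamma> (Suc n)) x
      - (real (Suc n) + \<gamma>) * poly (assoc_charlier a \<gamma> n) x"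
    using arg_cong[OF assoc_charlier_recurrence[OF assms(1), of \<gamma> n], of "\<lambda>p. poly p x"]
    by (simp add: algebra_simps del: assoc_charlier.simps)
  then have "a * poly (assoc_charlier a \<gamma> (Suc (Suc n))) x = a * charlier_sum a \<gamma> x (Suc (Suc n))"
    by (simp only: ge2 charlier_sum_recurrence[OF assms])
  then show ?case using assms(1) by simp
qed

section \<open>Reduction of the hypergeometric expression to the sums\<close>

lemma pochhammer_minus_nat:
  assumes "m \<le> n"
  shows "pochhammer (- real n) m = (- 1) ^ m * fact n / fact (n - m)"
proof -
  \<comment> \<open>Both sides are the binomial coefficient \<open>n choose m\<close>.\<close>
  have "(- 1) ^ m * pochhammer (- real n) m / fact m = fact n / (fact m * fact (n - m))"
    using assms by (simp flip: gbinomial_pochhammer binomial_gbinomial add: binomial_fact)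
  then have "(- 1) ^ m * pochhammer (- real n) m = fact n / fact (n - m)"
    by (simp add: field_simps)
  then have "(- 1) ^ m * ((- 1) ^ m * pochhammer (- real n) m) = (- 1) ^ m * fact n / fact (n - m)"
    by simp
  then show ?thesis
    by (simp flip: mult.assoc power_mult_distrib)
qed

text \<open>Here \<open>y\<close> stands for \<open>\<gamma> - x\<close>. Both
  \<open>(y)_k (y + k)_j\<close> and \<open>(y)_j (y + j)_k\<close> equal \<open>(y)_{k+j}\<close>,
  so the denominator \<open>(y)_j\<close> cancels; this is where it must be nonzero.\<close>

lemma explicit_term:
  assumes "k + j \<le> n" "pochhammer y j \<noteq> 0"
  shows "pochhammer (\<gamma> + 1) n / fact n *
      ((- a) powi (- int k) * (pochhammer (- real n) k * pochhammer y k / pochhammer (\<gamma> + 1) k) *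
       (pochhammer (- real (n - k)) j * pochhammer (y + real k) j * pochhammer \<gamma> j /
        (pochhammer y j * pochhammer (\<gamma> + real k + 1) j * fact j))) =
    charlier_weight \<gamma> n (k + j) *
      ((- 1 / a) ^ k * pochhammer (y + real j) k * (pochhammer \<gamma> j / fact j))"
proof -
  have minus_n: "pochhammer (- real n) k * pochhammer (- real (n - k)) j =
      (- 1) ^ (k + j) * fact n / fact (n - (k + j))"
    using assms(1) pochhammer_minus_nat[OF assms(1)] pochhammer_product'[of "- real n" k j]
    by (simp add: of_nat_diff)
  have y: "pochhammer y k * pochhammer (y + real k) j = pochhammer y j * pochhammer (y + real j) k"
    by (metis add.commute pochhammer_product')
  have \<gamma>: "pochhammer (\<gamma> + 1) k * pochhammer (\<gamma> + real k + 1) j = pochhammer (\<gamma> + 1) (k + j)"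
    using pochhammer_product'[of "\<gamma> + 1" k j] by (simp add: add_ac)
  have pow: "(- a) powi (- int k) = (- 1 / a) ^ k"
  proof -
    have "- 1 / a = inverse (- a)"
      by (simp add: inverse_eq_divide)
    then show ?thesis
      by (simp only: power_int_minus power_int_of_nat power_inverse)
  qed
  have "pochhammer (\<gamma> + 1) n / fact n *
      ((- a) powi (- int k) * (pochhammer (- real n) k * pochhammer y k / pochhammer (\<gamma> + 1) k) *
       (pochhammer (- real (n - k)) j * pochhammer (y + real k) j * pochhammer \<gamma> j /
        (pochhammer y j * pochhammer (\<gamma> + real k + 1) j * fact j))) =
    pochhammer (\<gamma> + 1) n / fact n * (- 1 / a) ^ k *
      (pochhammer (- real n) k * pochhammer (- real (n - k)) j) *
      (pochhammer y k * pochhammer (y + real k) j) / pochhammer y j *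
      (pochhammer \<gamma> j / fact j) / (pochhammer (\<gamma> + 1) k * pochhammer (\<gamma> + real k + 1) j)"
    unfolding pow by (simp add: mult_ac)
  also have "\<dots> = charlier_weight \<gamma> n (k + j) *
      ((- 1 / a) ^ k * pochhammer (y + real j) k * (pochhammer \<gamma> j / fact j))"
    unfolding minus_n y \<gamma> using assms by (simp add: charlier_weight_def mult_ac)
  finally show ?thesis .
qed

lemma assoc_charlier_explicit_eq_charlier_sum:
  assumes "\<forall>j\<le>n. pochhammer (\<gamma> - x) j \<noteq> 0"
  shows "assoc_charlier_explicit a \<gamma> n x = charlier_sum a \<gamma> x n"
proof -
  define f where "f k j = charlier_weight \<gamma> n (k + j) *
      ((- 1 / a) ^ k * pochhammer (\<gamma> - x + real j) k * (pochhammer \<gamma> j / fact j))" for k j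
  have "assoc_charlier_explicit a \<gamma> n x = (\<Sum>k\<le>n. \<Sum>j\<le>n - k. f k j)"
    unfolding assoc_charlier_explicit_def terminating_3F2_def sum_distrib_left atMost_atLeast0 f_def
    using assms by (intro sum.cong refl explicit_term) auto
  \<comment> \<open>The triangle \<open>k + j \<le> n\<close> is then summed along its diagonals
    \<open>k + j = m\<close>.\<close>
  also have "\<dots> = (\<Sum>(k, j)\<in>{(k, j). k + j \<le> n}. f k j)"
    by (subst sum.Sigma) (auto intro!: sum.cong)
  also have "\<dots> = (\<Sum>m\<le>n. \<Sum>k\<le>m. f k (m - k))"
    by (rule sum.triangle_reindex_eq)
  also have "\<dots> = charlier_sum a \<gamma> x n"
    unfolding charlier_sum_def charlier_inner_def sum_distrib_left f_def
    by (intro sum.cong refl) simp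
  finally show ?thesis .
qed

section \<open>Passage to the limit at the exceptional points\<close>

lemma eventually_pochhammer_nonzero:
  fixes \<gamma> x :: real
  shows "eventually (\<lambda>t. \<forall>j\<le>n. pochhammer (\<gamma> - t) j \<noteq> 0) (at x)"
proof -
  \<comment> \<open>A zero \<open>t\<close> of some \<open>(\<gamma> - t)_j\<close> with
    \<open>j \<le> n\<close> has the form \<open>\<gamma> + i\<close>, and a finite set has no limit
    points.\<close>
  have "finite ((\<lambda>i. \<gamma> + real i) ` {..n})"
    by simp
  then have "eventually (\<lambda>t. t \<notin> (\<lambda>i. \<gamma> + real i) ` {..n}) (at x)"
    using islimpt_finite islimpt_iff_eventually by metis
  then show ?thesis
    by eventually_elim (auto simp: pochhammer_eq_0_iff algebra_simps)
qed

text \<open>Literal equality is claimed only where no \<open>(\<gamma> - x)_j\<close> vanishes; the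
  limit expresses the convention of continuity at the remaining points, as \<open>at x\<close>
  ignores the value at \<open>x\<close> itself.\<close>

theorem mainTheorem7:
  fixes a \<gamma> :: real and n :: nat
  assumes "a > 0" and "\<gamma> \<ge> 0"
  shows "(\<forall>x. (\<forall>j\<le>n. pochhammer (\<gamma> - x) j \<noteq> 0)
              \<longrightarrow> poly (assoc_charlier a \<gamma> n) x = assoc_charlier_explicit a \<gamma> n x)
       \<and> (\<forall>x. ((\<lambda>t. assoc_charlier_explicit a \<gamma> n t)
                 \<longlongrightarrow> poly (assoc_charlier a \<gamma> n) x) (at x))"
proof -
  have eq: "poly (assoc_charlier a \<gamma> n) x = assoc_charlier_explicit a \<gamma> n x"
    if "\<forall>j\<le>n. pochhammer (\<gamma> - x) j \<noteq> 0" for x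
    using that assms poly_assoc_charlier assoc_charlier_explicit_eq_charlier_sum by simp
  have "((\<lambda>t. assoc_charlier_explicit a \<gamma> n t) \<longlongrightarrow> poly (assoc_charlier a \<gamma> n) x) (at x)" for x
  \<comment> \<open>The polynomial is continuous and agrees with the explicit expression on a
    punctured neighbourhood of \<open>x\<close>.\<close>
  proof (rule Lim_transform_eventually)
    show "(poly (assoc_charlier a \<gamma> n) \<longlongrightarrow> poly (assoc_charlier a \<gamma> n) x) (at x)"
      using poly_isCont by (simp add: isCont_def)
    show "eventually (\<lambda>t. poly (assoc_charlier a \<gamma> n) t = assoc_charlier_explicit a \<gamma> n t) (at x)"
      using eventually_pochhammer_nonzero by eventually_elim (rule eq)
  qed
  with eq show ?thesis by blast
qed

end
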